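(* Let $n\ge2$ and let $X_n:\mathcal{S}_n\to\mathbb{N}_0$ be the random variable $X_n(\pi)=\mathrm{lbsum}(\pi)$, where $\mathcal{S}_n$ carries the uniform probability distribution. Then $$\mathsf{E}(X_n)=(n+1)\left(\frac n2-H_{n,1}\right)+n,$$ $$\mathrm{Var}(X_n)=2n(n+2)-(n+1)H_{n,1}-(n+1)^2H_{n,2},$$ where $H_{n,m}=1+\frac1{2^m}+\cdots+\frac1{n^m}$ is the harmonic number of order $m$.
   Context: $\mathcal{S}_n$ is the set of permutations $\pi=\pi_1\cdots\pi_n$ of $\{1,\ldots,n\}$. The left border number $a_i$ of $\pi$ is the largest position $m<i$ with $\pi_m>\pi_i$, or $0$ if no such position exists, and $\mathrm{lbsum}(\pi)=a_1+\cdots+a_n$. *)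

theory Defs
  imports "HOL-Probability.Probability" "HOL-Combinatorics.Permutations"
begin

text \<open>
  A permutation \<open>\<pi>\<^sub>1\<cdots>\<pi>\<^sub>n\<close> of \<open>{1..n}\<close> is a function \<open>\<pi>\<close> with \<open>\<pi> permutes {1..n}\<close>,
  where \<open>\<pi>\<^sub>i\<close> is \<open>\<pi> i\<close>. Positions are numbered from 1, so the value 0 of the left border
  number marks that no larger entry occurs to the left.
\<close>

definition left_border :: "(nat \<Rightarrow> nat) \<Rightarrow> nat \<Rightarrow> nat" where
  "left_border \<pi> i = Max (insert 0 {m \<in> {1..<i}. \<pi> m > \<pi> i})"

definition lbsum :: "nat \<Rightarrow> (nat \<Rightarrow> nat) \<Rightarrow> nat" where
  "lbsum n \<pi> = (\<Sum>i=1..n. left_border \<pi> i)"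

definition uniform_perm :: "nat \<Rightarrow> (nat \<Rightarrow> nat) pmf" where
  "uniform_perm n = pmf_of_set {\<pi>. \<pi> permutes {1..n}}"

definition harm_order :: "nat \<Rightarrow> nat \<Rightarrow> real" where
  "harm_order n m = (\<Sum>k=1..n. 1 / real k ^ m)"

lemma harm_order_1: "harm_order n 1 = harm n"
  by (simp add: harm_order_def harm_def field_simps)

end

theory Submission
  imports Defs
begin

text \<open>
  Let \<open>I m i\<close> be the indicator that \<open>\<pi>\<^sub>i\<close> is the largest among \<open>\<pi>\<^sub>m, \<dots>, \<pi>\<^sub>i\<close>. The left border number
  of \<open>i\<close> is \<open>i\<close> minus the sum of \<open>I m i\<close> over \<open>1 \<le> m \<le> i\<close>, so \<open>lbsum\<close> is \<open>n(n+1)/2\<close> minus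
  the sum of all these indicators. Exchanging entries at positions of a set \<open>A\<close> shows that the maximum
  over \<open>A\<close> is equally likely to be at each position of \<open>A\<close>, even conditionally on an event which is
  invariant under such exchanges. Hence \<open>I m i\<close> has mean \<open>1/(i-m+1)\<close>, and for \<open>i < i'\<close> the indicators
  \<open>I m i\<close> and \<open>I m' i'\<close> are uncorrelated unless \<open>m < m' \<le> i\<close>; in that case
  \<open>I m i * I m' i' = I m i * I m i'\<close>. The moments are then sums of harmonic type.
\<close>

declare One_nat_def [simp del]

section \<open>Harmonic sums\<close>

lemma harm_order_0 [simp]: "harm_order 0 m = 0"
  by (simp add: harm_order_def)

lemma harm_order_Suc: "harm_order (Suc n) m = harm_order n m + 1 / (real n + 1) ^ m"
  by (simp add: harm_order_def add.commute)

lemma sum_harm_order_1: "(\<Sum>i=1..n. harm_order i 1) = (real n + 1) * harm_order n 1 - real n"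
proof (induction n)
  case (Suc n)
  have "(real n + 2) * (1 / (real n + 1)) = 1 + 1 / (real n + 1)"
    by (simp add: field_simps)
  then show ?case by (simp add: Suc.IH harm_order_Suc distrib_left) (simp add: algebra_simps)
qed simp

lemma sum_reciprocal_shift: "(\<Sum>j<n. 1 / (real j + 1)) = harm_order n 1"
  by (induction n) (simp_all add: harm_order_Suc)

lemma sum_reciprocal_flip: "(\<Sum>j<n. 1 / (real n - real j)) = harm_order n 1"
proof -
  have "(\<Sum>j<n. 1 / (real n - real j)) = (\<Sum>j<n. 1 / (real (n - Suc j) + 1))"
    by (intro sum.cong) (auto simp: of_nat_diff)
  also have "\<dots> = harm_order n 1"
    using sum.nat_diff_reindex[of "\<lambda>j. 1 / (real j + 1)" n] by (simp add: sum_reciprocal_shift)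
  finally show ?thesis .
qed

text \<open>Raising \<open>n\<close> by one adds \<open>1 / ((j + 1) * (n + 1 - j))\<close> to the
  summand at \<open>j\<close>. By partial fractions these terms add up to
  \<open>2 * harm_order (Suc n) 1 / (n + 2)\<close>, which is the increment of the right-hand
  side.\<close>

lemma harm_order_convolution:
  "(\<Sum>j<n. harm_order (n - j) 1 / (real j + 1)) = (harm_order (Suc n) 1)\<^sup>2 - harm_order (Suc n) 2"
proof (induction n)
  case 0
  show ?case by (simp add: harm_order_def)
next
  case (Suc n)
  have "(\<Sum>j<Suc n. harm_order (Suc n - j) 1 / (real j + 1))
      = (\<Sum>j<Suc n. harm_order (n - j) 1 / (real j + 1)
           + 1 / ((real j + 1) * (real (Suc n) - real j)))"
  proof (intro sum.cong refl)
    fix j assume "j \<in> {..<Suc n}"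
    then have "harm_order (Suc n - j) 1 = harm_order (n - j) 1 + 1 / (real (Suc n) - real j)"
      by (simp add: Suc_diff_le harm_order_Suc of_nat_diff algebra_simps)
    then show "harm_order (Suc n - j) 1 / (real j + 1)
        = harm_order (n - j) 1 / (real j + 1) + 1 / ((real j + 1) * (real (Suc n) - real j))"
      by (simp only: add_divide_distrib divide_divide_eq_left mult.commute)
  qed
  \<comment> \<open>The summand at \<open>j = n\<close> contains \<open>harm_order 0 1 = 0\<close>,
    so the sum of the induction hypothesis reappears.\<close>
  also have "\<dots> = (\<Sum>j<n. harm_order (n - j) 1 / (real j + 1))
           + (\<Sum>j<Suc n. 1 / ((real j + 1) * (real (Suc n) - real j)))"
    by (simp add: sum.distrib)
  also have "(\<Sum>j<Suc n. 1 / ((real j + 1) * (real (Suc n) - real j)))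
      = (\<Sum>j<Suc n. (1 / (real j + 1) + 1 / (real (Suc n) - real j)) / (real n + 2))"
  proof (intro sum.cong refl)
    fix j assume "j \<in> {..<Suc n}"
    then have "real j + 1 \<noteq> 0" "real (Suc n) - real j \<noteq> 0" by auto
    then have "1 / (real j + 1) + 1 / (real (Suc n) - real j)
        = (real n + 2) / ((real j + 1) * (real (Suc n) - real j))"
      by (simp add: add_frac_eq)
    then show "1 / ((real j + 1) * (real (Suc n) - real j))
        = (1 / (real j + 1) + 1 / (real (Suc n) - real j)) / (real n + 2)"
      by simp
  qed
  also have "\<dots> = 2 * harm_order (Suc n) 1 / (real n + 2)"
    unfolding sum_divide_distrib [symmetric] sum.distrib sum_reciprocal_shift sum_reciprocal_flip
    by simp
  finally show ?case
    unfolding Suc.IH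
    by (simp add: harm_order_Suc[of "Suc n"] power2_sum power_one_over add.commute[of 2])
qed

text \<open>The subtracted terms run from \<open>1 / t\<close> down to
  \<open>1 / (t - j + 1)\<close>, the last \<open>j\<close> terms of
  \<open>harm_order t 1\<close>.\<close>

lemma sum_overlap_inner:
  assumes "j < t"
  shows "(\<Sum>s=1..j. 1 / (real t + 1) - 1 / (real t - real s + 1))
    = real j / (real t + 1) - (harm_order t 1 - harm_order (t - j) 1)"
  using assms
proof (induction j)
  case (Suc j)
  have "t - j = Suc (t - Suc j)" using Suc.prems by simp
  then have "harm_order (t - j) 1 = harm_order (t - Suc j) 1 + 1 / (real t - real j)"
    using Suc.prems harm_order_Suc[of "t - Suc j" 1] by (simp add: of_nat_diff)
  then show ?case using Suc by (simp add: add_divide_distrib)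
qed simp

text \<open>With \<open>t = Suc k - m\<close> this is the covariance of the indicators of all blocks
  \<open>{m..i}\<close>, \<open>m \<le> i \<le> k\<close>, with the record count at
  \<open>Suc k\<close>. The convolution handles the mixed terms, and the squares of
  \<open>harm_order t 1\<close> cancel.\<close>

lemma sum_overlap:
  "(\<Sum>j<t. (\<Sum>s=1..j. 1 / (real t + 1) - 1 / (real t - real s + 1)) / (real j + 1))
    = (real t + harm_order t 1) / (real t + 1) - harm_order t 2"
proof -
  have "(\<Sum>j<t. (\<Sum>s=1..j. 1 / (real t + 1) - 1 / (real t - real s + 1)) / (real j + 1))
      = (\<Sum>j<t. 1 / (real t + 1) * (1 - 1 / (real j + 1)) - harm_order t 1 * (1 / (real j + 1))
           + harm_order (t - j) 1 / (real j + 1))"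
    by (intro sum.cong refl, subst sum_overlap_inner) (auto simp: divide_simps, simp add: algebra_simps)
  also have "\<dots> = 1 / (real t + 1) * (real t - harm_order t 1) - harm_order t 1 * harm_order t 1
      + ((harm_order (Suc t) 1)\<^sup>2 - harm_order (Suc t) 2)"
    unfolding sum.distrib sum_subtractf sum_distrib_left [symmetric] sum_reciprocal_shift
      harm_order_convolution by simp
  also have "\<dots> = (real t + harm_order t 1) / (real t + 1) - harm_order t 2"
    by (simp add: harm_order_Suc power2_sum power_one_over power2_eq_square[of "harm_order t 1"]
        add_divide_distrib diff_divide_distrib)
  finally show ?thesis .
qed

text \<open>Summing over the left ends \<open>m\<close> gives the covariance of the first
  \<open>k\<close> record counts with the next one.\<close>

lemma sum_overlap_total:
  "(\<Sum>t=1..k. (real t + harm_order t 1) / (real t + 1) - harm_order t 2)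
    = real k + 1 - harm_order (Suc k) 1 + ((harm_order (Suc k) 1)\<^sup>2 - harm_order (Suc k) 2) / 2
      - (real k + 1) * harm_order k 2 + harm_order k 1"
proof (induction k)
  case 0
  show ?case by (simp add: harm_order_def)
next
  case (Suc k)
  \<comment> \<open>In these variables the claim becomes a polynomial identity modulo the two
    defining equations of \<open>x\<close> and \<open>y\<close>, which \<open>algebra\<close> can
    decide.\<close>
  define x y h p where "x = 1 / (real k + 1)" and "y = 1 / (real k + 2)"
    and "h = harm_order (Suc k) 1" and "p = harm_order (Suc k) 2"
  have x: "(real k + 1) * x = 1" and y: "(real k + 2) * y = 1"
    by (simp_all add: x_def y_def)
  have step: "harm_order k 1 = h - x" "harm_order k 2 = p - x\<^sup>2"
      "harm_order (Suc (Suc k)) 1 = h + y" "harm_order (Suc (Suc k)) 2 = p + y\<^sup>2"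
    by (simp_all add: h_def p_def x_def y_def harm_order_Suc power_one_over add.commute)
  have "(\<Sum>t=1..Suc k. (real t + harm_order t 1) / (real t + 1) - harm_order t 2)
      = (real k + 1 - h + (h\<^sup>2 - p) / 2 - (real k + 1) * (p - x\<^sup>2) + (h - x))
        + ((real k + 1 + h) * y - p)"
    using Suc.IH by (simp add: step flip: h_def p_def) (simp add: y_def add.commute)
  also have "\<dots> = real k + 2 - (h + y) + ((h + y)\<^sup>2 - (p + y\<^sup>2)) / 2 - (real k + 2) * p + h"
    using x y by (simp add: field_simps) algebra
  finally show ?case by (simp add: step flip: h_def p_def)
qed

lemma sum_reciprocal_interval:
  shows "(\<Sum>m=1..i. 1 / real (i + 1 - m)) = harm_order i 1"
proof -
  have "(\<Sum>m=1..i. 1 / real (i + 1 - m)) = (\<Sum>k=1..i. 1 / real k)"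
    by (rule sum.reindex_bij_witness[of _ "\<lambda>k. i + 1 - k" "\<lambda>k. i + 1 - k"]) auto
  then show ?thesis by (simp add: harm_order_def)
qed

text \<open>Exactly \<open>2 * c - 1\<close> pairs have maximum \<open>c\<close>, so each
  \<open>c\<close> contributes \<open>2 - 1 / c\<close>. The induction adds the row and the column
  of \<open>Suc k\<close>.\<close>

lemma sum_reciprocal_max: "(\<Sum>a=1..k. \<Sum>b=1..k. 1 / real (max a b)) = 2 * real k - harm_order k 1"
proof (induction k)
  case (Suc k)
  have "(\<Sum>a=1..k. 1 / real (max a (Suc k))) = (\<Sum>a=1..k. 1 / (real k + 1))"
       "(\<Sum>a=1..k. 1 / real (max (Suc k) a)) = (\<Sum>a=1..k. 1 / (real k + 1))"
    by (intro sum.cong; simp add: max_def add.commute)+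
  moreover have "1 / (real k + 1) + 2 * (real k / (real k + 1)) = 2 - 1 / (real k + 1)"
    by (simp add: field_simps)
  ultimately show ?case
    using Suc by (simp add: sum.distrib harm_order_Suc add.commute)
qed simp

section \<open>Means and covariances over permutations\<close>

text \<open>As a finite sum, the expectation is linear and can be reindexed without integrability
  conditions.\<close>

definition perm_mean :: "nat \<Rightarrow> ((nat \<Rightarrow> nat) \<Rightarrow> real) \<Rightarrow> real" where
  "perm_mean n f = (\<Sum>\<pi> | \<pi> permutes {1..n}. f \<pi>) / fact n"

definition perm_cov :: "nat \<Rightarrow> ((nat \<Rightarrow> nat) \<Rightarrow> real) \<Rightarrow> ((nat \<Rightarrow> nat) \<Rightarrow> real) \<Rightarrow> real" where
  "perm_cov n f g = perm_mean n (\<lambda>\<pi>. f \<pi> * g \<pi>) - perm_mean n f * perm_mean n g"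

lemma expectation_uniform_perm: "measure_pmf.expectation (uniform_perm n) f = perm_mean n f"
proof -
  have "{\<pi>. \<pi> permutes {1..n}} \<noteq> {}" using permutes_id by blast
  then show ?thesis
    by (simp add: uniform_perm_def perm_mean_def integral_pmf_of_set finite_permutations card_permutations)
qed

lemma perm_mean_cong:
  "(\<And>\<pi>. \<pi> permutes {1..n} \<Longrightarrow> f \<pi> = g \<pi>) \<Longrightarrow> perm_mean n f = perm_mean n g"
  by (simp add: perm_mean_def)

lemma perm_mean_const [simp]: "perm_mean n (\<lambda>_. c) = c"
  by (simp add: perm_mean_def card_permutations)

lemma perm_mean_add: "perm_mean n (\<lambda>\<pi>. f \<pi> + g \<pi>) = perm_mean n f + perm_mean n g"
  by (simp add: perm_mean_def sum.distrib add_divide_distrib)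

lemma perm_mean_diff: "perm_mean n (\<lambda>\<pi>. f \<pi> - g \<pi>) = perm_mean n f - perm_mean n g"
  by (simp add: perm_mean_def sum_subtractf diff_divide_distrib)

lemma perm_mean_cmult: "perm_mean n (\<lambda>\<pi>. c * f \<pi>) = c * perm_mean n f"
  by (simp add: perm_mean_def sum_distrib_left)

lemma perm_mean_sum: "perm_mean n (\<lambda>\<pi>. \<Sum>x\<in>A. f x \<pi>) = (\<Sum>x\<in>A. perm_mean n (f x))"
  by (simp add: perm_mean_def sum_divide_distrib [symmetric] sum.swap[of _ A])

lemma perm_cov_sum_left: "perm_cov n (\<lambda>\<pi>. \<Sum>x\<in>A. f x \<pi>) g = (\<Sum>x\<in>A. perm_cov n (f x) g)"
  by (simp add: perm_cov_def sum_distrib_right perm_mean_sum sum_subtractf)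

lemma perm_cov_sum_right: "perm_cov n f (\<lambda>\<pi>. \<Sum>x\<in>A. g x \<pi>) = (\<Sum>x\<in>A. perm_cov n f (g x))"
  by (simp add: perm_cov_def sum_distrib_left perm_mean_sum sum_subtractf)

lemma perm_cov_add_self:
  "perm_cov n (\<lambda>\<pi>. f \<pi> + g \<pi>) (\<lambda>\<pi>. f \<pi> + g \<pi>)
    = perm_cov n f f + 2 * perm_cov n f g + perm_cov n g g"
proof -
  have "(\<lambda>\<pi>. (f \<pi> + g \<pi>) * (f \<pi> + g \<pi>)) = (\<lambda>\<pi>. f \<pi> * f \<pi> + 2 * (f \<pi> * g \<pi>) + g \<pi> * g \<pi>)"
    by (simp add: algebra_simps)
  then show ?thesis
    by (simp add: perm_cov_def perm_mean_add perm_mean_cmult) (simp add: algebra_simps)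
qed

lemma variance_uniform_perm: "measure_pmf.variance (uniform_perm n) f = perm_cov n f f"
proof -
  define c where "c = perm_mean n f"
  have "(\<lambda>\<pi>. (f \<pi> - c)\<^sup>2) = (\<lambda>\<pi>. f \<pi> * f \<pi> - 2 * c * f \<pi> + c\<^sup>2)"
    by (simp add: power2_eq_square algebra_simps)
  then show ?thesis
    unfolding expectation_uniform_perm perm_cov_def c_def [symmetric]
    by (simp add: perm_mean_add perm_mean_diff perm_mean_cmult power2_eq_square flip: c_def)
qed

lemma perm_cov_const_diff_self:
  "perm_cov n (\<lambda>\<pi>. c - f \<pi>) (\<lambda>\<pi>. c - f \<pi>) = perm_cov n f f"
proof -
  have "(\<lambda>\<pi>. (c - f \<pi>) * (c - f \<pi>)) = (\<lambda>\<pi>. c * c - 2 * c * f \<pi> + f \<pi> * f \<pi>)"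
    by (simp add: algebra_simps)
  then show ?thesis
    by (simp add: perm_cov_def perm_mean_diff perm_mean_add perm_mean_cmult) (simp add: algebra_simps)
qed

section \<open>Exchange of positions and the location of the maximum\<close>

lemma perm_mean_compose_transpose:
  assumes "a \<in> {1..n}" "b \<in> {1..n}"
  shows "perm_mean n (\<lambda>\<pi>. f (\<pi> \<circ> Transposition.transpose a b)) = perm_mean n f"
proof -
  let ?\<tau> = "Transposition.transpose a b"
  have perm: "\<pi> \<circ> ?\<tau> permutes {1..n}" if "\<pi> permutes {1..n}" for \<pi>
    using permutes_compose[OF permutes_swap_id[OF assms] that] .
  have "(\<Sum>\<pi> | \<pi> permutes {1..n}. f (\<pi> \<circ> ?\<tau>)) = (\<Sum>\<pi> | \<pi> permutes {1..n}. f \<pi>)"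
    by (rule sum.reindex_bij_witness[of _ "\<lambda>\<pi>. \<pi> \<circ> ?\<tau>" "\<lambda>\<pi>. \<pi> \<circ> ?\<tau>"])
      (simp_all add: perm comp_assoc)
  then show ?thesis by (simp add: perm_mean_def)
qed

text \<open>For \<open>A = {m..i}\<close> this is the indicator \<open>I m i\<close>. General sets
  suit the exchange argument, which never uses the order of the positions.\<close>

definition max_at :: "nat set \<Rightarrow> nat \<Rightarrow> (nat \<Rightarrow> nat) \<Rightarrow> real" where
  "max_at A i \<pi> = of_bool (\<forall>j\<in>A. \<pi> j \<le> \<pi> i)"

lemma sum_max_at:
  assumes "finite A" "A \<noteq> {}" "inj \<pi>"
  shows "(\<Sum>i\<in>A. max_at A i \<pi>) = 1"
proof -
  have "Max (\<pi> ` A) \<in> \<pi> ` A" using assms by simp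
  then obtain k where k: "k \<in> A" "\<pi> k = Max (\<pi> ` A)" by (metis imageE)
  then have ge: "\<forall>j\<in>A. \<pi> j \<le> \<pi> k" using assms by simp
  have "max_at A i \<pi> = of_bool (i = k)" if "i \<in> A" for i
  proof -
    have "(\<forall>j\<in>A. \<pi> j \<le> \<pi> i) \<longleftrightarrow> \<pi> i = \<pi> k"
      using ge k(1) that by (auto intro: antisym)
    then show ?thesis using assms(3) by (simp add: max_at_def inj_eq)
  qed
  then show ?thesis using assms k by (simp add: of_bool_def)
qed

text \<open>An exchange inside \<open>A\<close> leaves the set of values on \<open>A\<close>
  unchanged and only moves the candidate position.\<close>

lemma max_at_compose_transpose:
  assumes "a \<in> A" "b \<in> A"
  shows "max_at A i (\<pi> \<circ> Transposition.transpose a b) = max_at A (Transposition.transpose a b i) \<pi>"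
proof -
  have "Transposition.transpose a b ` A = A" using assms by simp
  then have "(\<forall>j\<in>A. \<pi> (Transposition.transpose a b j) \<le> x) = (\<forall>j\<in>A. \<pi> j \<le> x)" for x
    by (metis image_eqI imageE)
  then show ?thesis by (simp add: max_at_def)
qed

text \<open>Exchanging \<open>i\<close> with \<open>k\<close> shows that all positions of
  \<open>A\<close> have the same \<open>f\<close>-weighted mean, and the indicators sum to 1. With
  \<open>f\<close> constant this gives the mean of an indicator; with \<open>f\<close> an invariant
  indicator it gives independence.\<close>

lemma perm_mean_max_at:
  assumes "A \<subseteq> {1..n}" "i \<in> A"
    and inv: "\<And>\<pi> a b. a \<in> A \<Longrightarrow> b \<in> A \<Longrightarrow> f (\<pi> \<circ> Transposition.transpose a b) = f \<pi>"
  shows "perm_mean n (\<lambda>\<pi>. f \<pi> * max_at A i \<pi>) = perm_mean n f / card A"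
proof -
  have fin: "finite A" using assms(1) finite_subset by blast
  have eq: "perm_mean n (\<lambda>\<pi>. f \<pi> * max_at A k \<pi>) = perm_mean n (\<lambda>\<pi>. f \<pi> * max_at A i \<pi>)"
    if "k \<in> A" for k
  proof -
    have "perm_mean n (\<lambda>\<pi>. f \<pi> * max_at A i \<pi>)
        = perm_mean n (\<lambda>\<pi>. f (\<pi> \<circ> Transposition.transpose i k) * max_at A i (\<pi> \<circ> Transposition.transpose i k))"
      using perm_mean_compose_transpose[of i n k "\<lambda>\<pi>. f \<pi> * max_at A i \<pi>"] assms(1,2) that
      by (simp add: subset_iff)
    then show ?thesis
      using assms(2) that by (simp add: inv max_at_compose_transpose)
  qed
  have "perm_mean n f = perm_mean n (\<lambda>\<pi>. f \<pi> * (\<Sum>k\<in>A. max_at A k \<pi>))"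
  proof (rule perm_mean_cong)
    fix \<pi> assume "\<pi> permutes {1..n}"
    then have "(\<Sum>k\<in>A. max_at A k \<pi>) = 1"
      using fin assms(2) permutes_inj by (intro sum_max_at) auto
    then show "f \<pi> = f \<pi> * (\<Sum>k\<in>A. max_at A k \<pi>)" by simp
  qed
  also have "\<dots> = (\<Sum>k\<in>A. perm_mean n (\<lambda>\<pi>. f \<pi> * max_at A k \<pi>))"
    by (simp add: sum_distrib_left perm_mean_sum)
  also have "\<dots> = card A * perm_mean n (\<lambda>\<pi>. f \<pi> * max_at A i \<pi>)"
    by (simp add: eq)
  finally show ?thesis
    using fin assms(2) by (auto simp: field_simps)
qed

lemma perm_mean_max_at_single:
  assumes "A \<subseteq> {1..n}" "i \<in> A"
  shows "perm_mean n (max_at A i) = 1 / card A"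
  using perm_mean_max_at[of A n i "\<lambda>_. 1"] assms by simp

text \<open>The second indicator serves as the invariant weight: an exchange inside \<open>A\<close>
  fixes \<open>k\<close> and either maps \<open>B\<close> to itself or does not touch it.\<close>

lemma perm_mean_max_at_pair:
  assumes "A \<subseteq> {1..n}" "i \<in> A" "B \<subseteq> {1..n}" "k \<in> B" "k \<notin> A"
    and "A \<subseteq> B \<or> A \<inter> B = {}"
  shows "perm_mean n (\<lambda>\<pi>. max_at A i \<pi> * max_at B k \<pi>) = 1 / (real (card A) * real (card B))"
proof -
  have "max_at B k (\<pi> \<circ> Transposition.transpose a b) = max_at B k \<pi>" if "a \<in> A" "b \<in> A" for \<pi> a b
  proof (cases "A \<subseteq> B")
    case True
    then show ?thesis
      using that assms(5) max_at_compose_transpose[of a B b k \<pi>]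
      by (metis subsetD transpose_apply_other)
  next
    case False
    then have "j \<noteq> a \<and> j \<noteq> b" if "j \<in> B" for j
      using assms(6) \<open>a \<in> A\<close> \<open>b \<in> A\<close> that by blast
    then show ?thesis using assms(4) by (simp add: max_at_def)
  qed
  from perm_mean_max_at[OF assms(1,2) this] show ?thesis
    by (simp add: perm_mean_max_at_single assms mult.commute)
qed

section \<open>Left border numbers\<close>

text \<open>The indicators are monotone in \<open>m\<close>, so this is the length of the longest
  block within \<open>{1..i}\<close> that ends at \<open>i\<close> and has its maximum
  there.\<close>

abbreviation record_count :: "nat \<Rightarrow> (nat \<Rightarrow> nat) \<Rightarrow> real" where
  "record_count i \<pi> \<equiv> \<Sum>m=1..i. max_at {m..i} i \<pi>"

text \<open>The indicator vanishes exactly for those \<open>m\<close> that do not exceed the left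
  border number.\<close>

lemma left_border_eq_record_count: "real (left_border \<pi> i) = real i - record_count i \<pi>"
proof -
  define S where "S = insert 0 {m \<in> {1..<i}. \<pi> m > \<pi> i}"
  have S: "finite S" "S \<noteq> {}" and b: "left_border \<pi> i = Max S"
    by (simp_all add: S_def left_border_def)
  have le: "left_border \<pi> i \<le> i"
    unfolding b using S by (subst Max_le_iff) (auto simp: S_def)
  have "max_at {m..i} i \<pi> = 1 - of_bool (m \<le> left_border \<pi> i)" if "m \<in> {1..i}" for m
  proof -
    have "m \<le> left_border \<pi> i \<longleftrightarrow> (\<exists>j\<in>S. m \<le> j)"
      unfolding b by (rule Max_ge_iff[OF S])
    \<comment> \<open>The default element 0 of \<open>S\<close> lies below every
      \<open>m \<ge> 1\<close>, and \<open>j = i\<close> is excluded by the strict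
      inequality.\<close>
    also have "\<dots> \<longleftrightarrow> (\<exists>j\<in>{m..i}. \<pi> j > \<pi> i)"
    proof
      assume "\<exists>j\<in>{m..i}. \<pi> j > \<pi> i"
      then obtain j where j: "j \<in> {m..i}" "\<pi> j > \<pi> i" by blast
      then have "j \<noteq> i" by auto
      then have "j \<in> S" using j that by (auto simp: S_def)
      then show "\<exists>j\<in>S. m \<le> j" using j by auto
    qed (use that in \<open>auto simp: S_def\<close>)
    also have "\<dots> \<longleftrightarrow> \<not> (\<forall>j\<in>{m..i}. \<pi> j \<le> \<pi> i)" by (simp add: not_le)
    finally show ?thesis by (simp only: max_at_def of_bool_def) simp
  qed
  then have "record_count i \<pi> = (\<Sum>m=1..i. 1 - of_bool (m \<le> left_border \<pi> i))"
    by (intro sum.cong) auto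
  also have "\<dots> = real i - real (card ({1..i} \<inter> {m. m \<le> left_border \<pi> i}))"
    by (simp add: sum_subtractf sum.If_cases of_bool_def)
  also have "{1..i} \<inter> {m. m \<le> left_border \<pi> i} = {1..left_border \<pi> i}"
    using le by auto
  finally show ?thesis by simp
qed

lemma real_lbsum:
  "real (lbsum n \<pi>) = real n * (real n + 1) / 2 - (\<Sum>i=1..n. record_count i \<pi>)"
proof -
  have "(\<Sum>i=1..n. real i) = real n * (real n + 1) / 2"
    by (induction n) (simp_all add: field_simps)
  then show ?thesis
    by (simp add: lbsum_def left_border_eq_record_count sum_subtractf)
qed

section \<open>Mean, variance and pairwise covariance of record counts\<close>

lemma perm_mean_record_count:
  assumes "i \<le> n"
  shows "perm_mean n (record_count i) = harm_order i 1"
proof -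
  have "perm_mean n (record_count i) = (\<Sum>m=1..i. 1 / real (i + 1 - m))"
    unfolding perm_mean_sum
    by (intro sum.cong refl, subst perm_mean_max_at_single) (use assms in auto)
  then show ?thesis using sum_reciprocal_interval by simp
qed

lemma max_at_mult_same:
  "max_at A i \<pi> * max_at B i \<pi> = max_at (A \<union> B) i \<pi>"
  by (auto simp: max_at_def)

text \<open>Two blocks ending at \<open>i\<close> have the longer one as their union, so a product
  of indicators has mean 1 over the larger length.\<close>

lemma perm_cov_record_count_self:
  assumes "i \<le> n"
  shows "perm_cov n (record_count i) (record_count i)
    = 2 * real i - harm_order i 1 - (harm_order i 1)\<^sup>2"
proof -
  have "perm_mean n (\<lambda>\<pi>. record_count i \<pi> * record_count i \<pi>)
      = (\<Sum>m=1..i. \<Sum>m'=1..i. perm_mean n (max_at ({m..i} \<union> {m'..i}) i))"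
    by (simp add: sum_product perm_mean_sum max_at_mult_same)
  also have "\<dots> = (\<Sum>m=1..i. \<Sum>m'=1..i. 1 / real (max (i + 1 - m) (i + 1 - m')))"
  proof (intro sum.cong refl)
    fix m m' assume "m \<in> {1..i}" "m' \<in> {1..i}"
    moreover have "{m..i} \<union> {m'..i} = {min m m'..i}" by auto
    ultimately show "perm_mean n (max_at ({m..i} \<union> {m'..i}) i)
        = 1 / real (max (i + 1 - m) (i + 1 - m'))"
      using assms by (subst perm_mean_max_at_single) (auto simp: min_def max_def)
  qed
  \<comment> \<open>Blocks are now indexed by their length \<open>i + 1 - m\<close> instead of their
    left end; the next step does the same for \<open>m'\<close>.\<close>
  also have "\<dots> = (\<Sum>a=1..i. \<Sum>m'=1..i. 1 / real (max a (i + 1 - m')))"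
    by (rule sum.reindex_bij_witness[of _ "\<lambda>k. i + 1 - k" "\<lambda>k. i + 1 - k"]) auto
  also have "\<dots> = (\<Sum>a=1..i. \<Sum>b=1..i. 1 / real (max a b))"
    by (rule sum.cong[OF refl], rule sum.reindex_bij_witness[of _ "\<lambda>k. i + 1 - k" "\<lambda>k. i + 1 - k"]) auto
  finally show ?thesis
    using assms by (simp add: perm_cov_def perm_mean_record_count sum_reciprocal_max power2_eq_square)
qed

text \<open>If \<open>m' \<le> m\<close> the first block lies inside the second, and if
  \<open>m' > i\<close> they are disjoint; both cases are uncorrelated. A proper overlap reduces to
  the nested case by extending the second block to \<open>{m..i'}\<close>.\<close>

lemma perm_cov_max_at:
  assumes "1 \<le> m" "m \<le> i" "i < i'" "1 \<le> m'" "m' \<le> i'" "i' \<le> n"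
  shows "perm_cov n (max_at {m..i} i) (max_at {m'..i'} i') =
    (if m < m' \<and> m' \<le> i
     then (1 / (real i' - real m + 1) - 1 / (real i' - real m' + 1)) / (real i - real m + 1) else 0)"
proof -
  have card: "real (card {a..b}) = real b - real a + 1" if "a \<le> b" for a b :: nat
    using that by (simp add: of_nat_diff)
  have mean: "perm_mean n (max_at {m..i} i) = 1 / (real i - real m + 1)"
      "perm_mean n (max_at {m'..i'} i') = 1 / (real i' - real m' + 1)"
    using assms by (subst perm_mean_max_at_single; auto simp: of_nat_diff)+
  show ?thesis
  proof (cases "m < m' \<and> m' \<le> i")
    case True
    \<comment> \<open>On the first event \<open>\<pi> i\<close> bounds the entries to the left of
      \<open>m'\<close>, and \<open>i\<close> lies in the second block, so \<open>\<pi> i'\<close>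
      bounds them as well.\<close>
    have "max_at {m..i} i \<pi> * max_at {m'..i'} i' \<pi> = max_at {m..i} i \<pi> * max_at {m..i'} i' \<pi>" for \<pi>
    proof -
      have "\<pi> j \<le> \<pi> i'" if "\<forall>j\<in>{m..i}. \<pi> j \<le> \<pi> i" "\<forall>j\<in>{m'..i'}. \<pi> j \<le> \<pi> i'" "j \<in> {m..i'}" for j
      proof (cases "j < m'")
        case j: True
        have "\<pi> j \<le> \<pi> i" using that(1,3) True j by auto
        also have "\<pi> i \<le> \<pi> i'" using that(2) True assms by auto
        finally show ?thesis .
      qed (use that in auto)
      then have "(\<forall>j\<in>{m..i'}. \<pi> j \<le> \<pi> i') \<longleftrightarrow> (\<forall>j\<in>{m'..i'}. \<pi> j \<le> \<pi> i')"
        if "\<forall>j\<in>{m..i}. \<pi> j \<le> \<pi> i"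
        using that True by (metis atLeastAtMost_iff less_imp_le order_trans)
      then show ?thesis by (auto simp: max_at_def)
    qed
    then have "perm_mean n (\<lambda>\<pi>. max_at {m..i} i \<pi> * max_at {m'..i'} i' \<pi>)
        = 1 / (real (card {m..i}) * real (card {m..i'}))"
      using assms by (simp only:) (rule perm_mean_max_at_pair; auto)
    also have "\<dots> = 1 / ((real i - real m + 1) * (real i' - real m + 1))"
      using assms by (simp add: card del: card_atLeastAtMost)
    finally show ?thesis
      using True by (simp add: perm_cov_def mean diff_divide_distrib mult.commute)
  next
    case False
    have "perm_mean n (\<lambda>\<pi>. max_at {m..i} i \<pi> * max_at {m'..i'} i' \<pi>)
        = 1 / (real (card {m..i}) * real (card {m'..i'}))"
      using assms False by (intro perm_mean_max_at_pair) auto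
    also have "\<dots> = 1 / ((real i - real m + 1) * (real i' - real m' + 1))"
      using assms by (simp add: card del: card_atLeastAtMost)
    finally show ?thesis
      using False by (simp add: perm_cov_def mean)
  qed
qed

section \<open>Total covariance and the variance of the sum\<close>

lemma sum_triangle_swap:
  fixes f :: "nat \<Rightarrow> nat \<Rightarrow> 'a::comm_monoid_add"
  shows "(\<Sum>i=1..k. \<Sum>m=1..i. f i m) = (\<Sum>m=1..k. \<Sum>i=m..k. f i m)"
  by (simp add: sum.Sigma)
    (rule sum.reindex_bij_witness[of _ "\<lambda>(x, y). (y, x)" "\<lambda>(x, y). (y, x)"]; auto)

text \<open>By bilinearity only properly overlapping blocks contribute. Their covariance depends
  only on distances from the common reference point \<open>m\<close>, so the sum over
  \<open>m\<close> is moved outermost.\<close>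

lemma perm_cov_record_count_Suc:
  assumes "Suc k \<le> n"
  shows "perm_cov n (\<lambda>\<pi>. \<Sum>i=1..k. record_count i \<pi>) (record_count (Suc k))
    = (\<Sum>t=1..k. (real t + harm_order t 1) / (real t + 1) - harm_order t 2)"
proof -
  \<comment> \<open>The covariance in the overlapping case, with \<open>i' = Suc k\<close>.\<close>
  define g where "g i m m' = (1 / (real (Suc k) - real m + 1) - 1 / (real (Suc k) - real m' + 1))
      / (real i - real m + 1)" for i m m'
  have "perm_cov n (\<lambda>\<pi>. \<Sum>i=1..k. record_count i \<pi>) (record_count (Suc k))
      = (\<Sum>i=1..k. \<Sum>m=1..i. \<Sum>m'=1..Suc k.
           perm_cov n (max_at {m..i} i) (max_at {m'..Suc k} (Suc k)))"
    by (simp only: perm_cov_sum_left perm_cov_sum_right)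
  also have "\<dots> = (\<Sum>i=1..k. \<Sum>m=1..i. \<Sum>m'=Suc m..i. g i m m')"
  proof (rule sum.cong[OF refl], rule sum.cong[OF refl])
    fix i m assume im: "i \<in> {1..k}" "m \<in> {1..i}"
    have "(\<Sum>m'=1..Suc k. perm_cov n (max_at {m..i} i) (max_at {m'..Suc k} (Suc k)))
        = (\<Sum>m'=1..Suc k. if m < m' \<and> m' \<le> i then g i m m' else 0)"
      unfolding g_def by (intro sum.cong refl perm_cov_max_at) (use im assms in auto)
    also have "\<dots> = (\<Sum>m'=Suc m..i. g i m m')"
      by (rule sum.mono_neutral_cong_right) (use im in auto)
    finally show "(\<Sum>m'=1..Suc k. perm_cov n (max_at {m..i} i) (max_at {m'..Suc k} (Suc k)))
        = (\<Sum>m'=Suc m..i. g i m m')" .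
  qed
  also have "\<dots> = (\<Sum>m=1..k. \<Sum>i=m..k. \<Sum>m'=Suc m..i. g i m m')"
    by (rule sum_triangle_swap)
  also have "\<dots> = (\<Sum>t=1..k. \<Sum>j<t. (\<Sum>s=1..j. 1 / (real t + 1) - 1 / (real t - real s + 1))
      / (real j + 1))"
  \<comment> \<open>The new indices are the distances \<open>t = Suc k - m\<close>,
    \<open>j = i - m\<close> and \<open>s = m' - m\<close>.\<close>
  proof (rule sum.reindex_bij_witness[of _ "\<lambda>t. Suc k - t" "\<lambda>m. Suc k - m"])
    fix m assume m: "m \<in> {1..k}"
    define t where "t = Suc k - m"
    have t: "Suc k = m + t" using m by (simp add: t_def)
    have "(\<Sum>i=m..k. \<Sum>m'=Suc m..i. g i m m') = (\<Sum>j<t. \<Sum>s=1..j. g (m + j) m (m + s))"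
    proof (rule sum.reindex_bij_witness[of _ "\<lambda>j. m + j" "\<lambda>i. i - m"])
      fix i assume i: "i \<in> {m..k}"
      show "(\<Sum>s=1..i - m. g (m + (i - m)) m (m + s)) = (\<Sum>m'=Suc m..i. g i m m')"
        by (rule sum.reindex_bij_witness[of _ "\<lambda>x. x - m" "\<lambda>s. m + s"]) (use i in auto)
    qed (use t in auto)
    also have "\<dots> = (\<Sum>j<t. (\<Sum>s=1..j. 1 / (real t + 1) - 1 / (real t - real s + 1)) / (real j + 1))"
      unfolding sum_divide_distrib by (simp add: g_def t del: of_nat_Suc)
    finally show "(\<Sum>j<Suc k - m. (\<Sum>s=1..j. 1 / (real (Suc k - m) + 1)
        - 1 / (real (Suc k - m) - real s + 1)) / (real j + 1))
        = (\<Sum>i=m..k. \<Sum>m'=Suc m..i. g i m m')"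
      by (simp only: t_def)
  qed auto
  finally show ?thesis by (simp only: sum_overlap)
qed

text \<open>Record counts are added one at a time while \<open>n\<close> stays fixed, so all of them
  live on the same permutations. Each step adds the variance of the new count and twice its
  covariance with the earlier ones; the squares of \<open>harm_order (Suc k) 1\<close> cancel
  between the two.\<close>

lemma perm_cov_sum_record_count:
  assumes "k \<le> n"
  shows "perm_cov n (\<lambda>\<pi>. \<Sum>i=1..k. record_count i \<pi>) (\<lambda>\<pi>. \<Sum>i=1..k. record_count i \<pi>)
    = 2 * real k * (real k + 2) - (real k + 1) * harm_order k 1 - (real k + 1)\<^sup>2 * harm_order k 2"
  using assms
proof (induction k)
  case 0
  show ?case by (simp add: perm_cov_def)
next
  case (Suc k)
  define Y where "Y = (\<lambda>\<pi>. \<Sum>i=1..k. record_count i \<pi>)"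
  have "(\<lambda>\<pi>. \<Sum>i=1..Suc k. record_count i \<pi>) = (\<lambda>\<pi>. Y \<pi> + record_count (Suc k) \<pi>)"
    by (simp add: Y_def)
  then have "perm_cov n (\<lambda>\<pi>. \<Sum>i=1..Suc k. record_count i \<pi>) (\<lambda>\<pi>. \<Sum>i=1..Suc k. record_count i \<pi>)
      = perm_cov n Y Y + 2 * perm_cov n Y (record_count (Suc k))
        + perm_cov n (record_count (Suc k)) (record_count (Suc k))"
    by (simp only: perm_cov_add_self)
  also have "perm_cov n Y Y
      = 2 * real k * (real k + 2) - (real k + 1) * harm_order k 1 - (real k + 1)\<^sup>2 * harm_order k 2"
    unfolding Y_def using Suc by simp
  also have "perm_cov n Y (record_count (Suc k)) = real k + 1 - harm_order (Suc k) 1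
      + ((harm_order (Suc k) 1)\<^sup>2 - harm_order (Suc k) 2) / 2
      - (real k + 1) * harm_order k 2 + harm_order k 1"
    unfolding Y_def perm_cov_record_count_Suc[OF Suc.prems] by (rule sum_overlap_total)
  also note perm_cov_record_count_self[OF Suc.prems]
  finally have *: "perm_cov n (\<lambda>\<pi>. \<Sum>i=1..Suc k. record_count i \<pi>)
      (\<lambda>\<pi>. \<Sum>i=1..Suc k. record_count i \<pi>) =
    2 * real k * (real k + 2) - (real k + 1) * harm_order k 1 - (real k + 1)\<^sup>2 * harm_order k 2
    + 2 * (real k + 1 - harm_order (Suc k) 1
      + ((harm_order (Suc k) 1)\<^sup>2 - harm_order (Suc k) 2) / 2
      - (real k + 1) * harm_order k 2 + harm_order k 1)
    + (2 * real (Suc k) - harm_order (Suc k) 1 - (harm_order (Suc k) 1)\<^sup>2)" .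
  \<comment> \<open>Again a polynomial identity, now modulo the single relation for
    \<open>x\<close>.\<close>
  define x where "x = 1 / (real k + 1)"
  have x: "(real k + 1) * x = 1" by (simp add: x_def)
  have step: "harm_order (Suc k) 1 = harm_order k 1 + x" "harm_order (Suc k) 2 = harm_order k 2 + x\<^sup>2"
    by (simp_all add: x_def harm_order_Suc power_one_over)
  show ?case
    unfolding * step of_nat_Suc using x by (simp add: field_simps) algebra
qed

theorem corollary2p3:
  fixes n :: nat
  assumes "n \<ge> 2"
  shows "measure_pmf.expectation (uniform_perm n) (\<lambda>\<pi>. real (lbsum n \<pi>))
           = (real n + 1) * (real n / 2 - harm_order n 1) + real n
       \<and> measure_pmf.variance (uniform_perm n) (\<lambda>\<pi>. real (lbsum n \<pi>))
           = 2 * real n * (real n + 2) - (real n + 1) * harm_order n 1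
             - (real n + 1)\<^sup>2 * harm_order n 2"
proof
  have "perm_mean n (\<lambda>\<pi>. real (lbsum n \<pi>))
      = real n * (real n + 1) / 2 - (\<Sum>i=1..n. harm_order i 1)"
    by (simp add: real_lbsum perm_mean_diff perm_mean_sum[of n _ "{1..n}"]
        perm_mean_record_count)
  then show "measure_pmf.expectation (uniform_perm n) (\<lambda>\<pi>. real (lbsum n \<pi>))
      = (real n + 1) * (real n / 2 - harm_order n 1) + real n"
    by (simp add: expectation_uniform_perm sum_harm_order_1 field_simps)
  show "measure_pmf.variance (uniform_perm n) (\<lambda>\<pi>. real (lbsum n \<pi>))
      = 2 * real n * (real n + 2) - (real n + 1) * harm_order n 1
        - (real n + 1)\<^sup>2 * harm_order n 2"
    \<comment> \<open>\<open>lbsum\<close> is a constant minus the total record count, and neither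
      the constant nor the sign affects the variance.\<close>
    unfolding variance_uniform_perm
    by (simp only: real_lbsum perm_cov_const_diff_self perm_cov_sum_record_count[OF order_refl])
qed

end
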